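(* Let $X_0,X_1,X_2,\ldots$ be an arbitrary sequence of real random variables (defined on a common probability space) with partial maxima $M_n=\max_{0\le j\le n-1}X_j$. Then the following conditions are equivalent. (i) $\{X_j\}$ admits a continuous phantom distribution function. (ii) $\{X_j\}$ admits a regular phantom distribution function. (iii) There exist $\beta>0$, a non-decreasing sequence of levels $\{v_n=v_n(\beta)\}\subset\mathbb{R}$ and a dense subset $D\subset\mathbb{R}^+$ such that $$\mathbb{P}\big(M_{[nt]}\le v_n(\beta)\big)\to\exp(-\beta t)\quad\text{as } n\to\infty,\qquad t\in D.$$ (iv) For every $\beta>0$ there exists a non-decreasing sequence of levels $\{v_n=v_n(\beta)\}\subset\mathbb{R}$ such that $$\mathbb{P}\big(M_{[nt]}\le v_n(\beta)\big)\to\exp(-\beta t)\quad\text{as } n\to\infty,\qquad\text{for every } t>0.$$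
   Context: A sequence $\{X_j\}$ (not necessarily stationary) with partial maxima $M_n=\max_{0\le j\le n-1}X_j$ admits a phantom distribution function $G$ (a probability distribution function on $\mathbb{R}$) if $$\sup_{x\in\mathbb{R}}\big|\mathbb{P}(M_n\le x)-G^n(x)\big|\to0\quad\text{as } n\to\infty,$$ where $G^n(x)=(G(x))^n$. For a distribution function $G$ put $G_*=\sup\{x: G(x)<1\}$ (possibly $+\infty$). $G$ is regular (in the sense of O'Brien) if $$G(G_*-)=1\quad\text{and}\quad\lim_{x\to G_*-}\frac{1-G(x-)}{1-G(x)}=1,$$ where $G(x-)$ denotes the left limit of $G$ at $x$. $[\,\cdot\,]$ denotes the integer part, and $\mathbb{R}^+=(0,\infty)$. *)

theory Defs
  imports "HOL-Probability.Probability"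
begin

(* For n = 0 this is the maximum of the empty set, an unspecified constant. Only limits as n tends
   to infinity are taken below, so finitely many such terms do not matter. *)
definition partial_max :: "(nat \<Rightarrow> 'a \<Rightarrow> real) \<Rightarrow> nat \<Rightarrow> 'a \<Rightarrow> real" where
  "partial_max X n \<omega> = (MAX j\<in>{0..<n}. X j \<omega>)"

definition distribution_function :: "(real \<Rightarrow> real) \<Rightarrow> bool" where
  "distribution_function G \<longleftrightarrow> (\<exists>N. real_distribution N \<and> G = cdf N)"

definition phantom_df :: "'a measure \<Rightarrow> (nat \<Rightarrow> 'a \<Rightarrow> real) \<Rightarrow> (real \<Rightarrow> real) \<Rightarrow> bool" where
  "phantom_df M X G \<longleftrightarrow> distribution_function G \<and>
     (\<lambda>n. SUP x::real. \<bar>measure M {\<omega>\<in>space M. partial_max X n \<omega> \<le> x} - G x ^ n\<bar>) \<longlonglongrightarrow> 0"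

definition right_end :: "(real \<Rightarrow> real) \<Rightarrow> ereal" where
  "right_end G = Sup (ereal ` {x. G x < 1})"

(* Real arguments tending from below to an extended real g:
   at_left g if g is finite, at_top if g is infinity. *)
definition at_left_ereal :: "ereal \<Rightarrow> real filter" where
  "at_left_ereal g = filtercomap ereal (at_left g)"

lemma at_left_ereal_simps:
  "at_left_ereal (ereal r) = at_left r"
  "at_left_ereal \<infinity> = at_top"
proof -
  have "filtercomap ereal (filtermap ereal F) = F" for F
  proof (rule filter_eq_iff[THEN iffD2], intro allI iffI)
    fix P assume "eventually P (filtercomap ereal (filtermap ereal F))"
    then show "eventually P F"
      by (auto simp: eventually_filtercomap eventually_filtermap elim: eventually_mono)
  next
    fix P assume "eventually P F"
    then show "eventually P (filtercomap ereal (filtermap ereal F))"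
      by (auto simp: eventually_filtercomap eventually_filtermap
          intro!: exI[of _ "\<lambda>y. P (real_of_ereal y)"])
  qed
  then show "at_left_ereal (ereal r) = at_left r" "at_left_ereal \<infinity> = at_top"
    by (simp_all add: at_left_ereal_def at_left_ereal at_left_PInf)
qed

definition left_limit :: "(real \<Rightarrow> real) \<Rightarrow> real \<Rightarrow> real" where
  "left_limit G x = Lim (at_left x) G"

definition regular_df :: "(real \<Rightarrow> real) \<Rightarrow> bool" where
  "regular_df G \<longleftrightarrow>
     (G \<longlongrightarrow> 1) (at_left_ereal (right_end G)) \<and>
     ((\<lambda>x. (1 - left_limit G x) / (1 - G x)) \<longlongrightarrow> 1) (at_left_ereal (right_end G))"

definition level_convergence ::
  "'a measure \<Rightarrow> (nat \<Rightarrow> 'a \<Rightarrow> real) \<Rightarrow> (nat \<Rightarrow> real) \<Rightarrow> real \<Rightarrow> real \<Rightarrow> bool" where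
  "level_convergence M X v \<beta> t \<longleftrightarrow>
     (\<lambda>n. measure M {\<omega>\<in>space M. partial_max X (nat \<lfloor>real n * t\<rfloor>) \<omega> \<le> v n})
       \<longlonglongrightarrow> exp (- \<beta> * t)"

end

theory Submission
  imports Defs
begin

text \<open>
  Write \<open>P n x\<close> for the probability that the maximum of the first \<open>n\<close> variables is at most \<open>x\<close>.
  Everything rests on three properties of these numbers: they lie in the unit interval, increase
  with \<open>x\<close> and decrease with \<open>n\<close>.

  From a regular phantom distribution function \<open>G\<close> to levels: let \<open>v n\<close> be the smallest point where
  \<open>1 - G\<close> has come down to about \<open>\<beta> / n\<close>. The tail may jump across that value at \<open>v n\<close>, but by
  regularity the relative size of the jump vanishes, so \<open>n * (1 - G (v n))\<close> still tends to \<open>\<beta>\<close>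
  (\<open>regular_levels\<close>). Hence \<open>G (v n) ^ k\<close> tends to \<open>exp (- \<beta> * t)\<close> for \<open>k = nat \<lfloor>real n * t\<rfloor>\<close>, and
  \<open>P\<close> follows \<open>G\<close> (\<open>regular_phantom_levels\<close>). A continuous distribution function is regular since it
  has no jumps at all (\<open>continuous_imp_regular\<close>).

  From levels on a dense set of times to a continuous phantom distribution function: the functions
  \<open>t \<mapsto> P (nat \<lfloor>real k * t\<rfloor>) (v k)\<close> are decreasing and converge on a dense set to the continuous
  limit \<open>exp (- \<beta> * t)\<close>, so Polya's argument makes the convergence uniform: \<open>P n (v k)\<close> is close to
  \<open>exp (- \<beta> * n / k)\<close> for all \<open>n \<ge> 1\<close> at once when \<open>k\<close> is large (\<open>uniform_in_index\<close>). Therefore any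
  monotone \<open>G = exp (- h)\<close> with \<open>h (v k)\<close> asymptotic to \<open>\<beta> / k\<close> has \<open>G (v k) ^ n\<close> close to \<open>P n (v k)\<close> for
  large \<open>k\<close>, uniformly in \<open>n\<close>, and between consecutive levels both are squeezed between values that
  are close to each other.

  The obstacle to a continuous \<open>h\<close> is that the levels may have ties: \<open>h\<close> then takes a single value
  on a whole block of indices. But if \<open>v a = v b\<close>, the uniform approximation with \<open>n = a\<close> shows
  that \<open>exp (- \<beta>)\<close> and \<open>exp (- \<beta> * a / b)\<close> are close, so the two ends of a block have a ratio near 1
  (\<open>index_ratio_tendsto\<close>) and a value of \<open>h\<close> fitted to either end serves the whole block
  (\<open>continuous_interpolation\<close>, \<open>continuous_phantom\<close>).
\<close>

section \<open>Regular distribution functions and their levels\<close>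

lemma less_one_below_right_end:
  assumes "distribution_function G" "ereal x < right_end G"
  shows "G x < 1"
proof -
  obtain N where N: "real_distribution N" "G = cdf N"
    using assms(1) unfolding distribution_function_def by blast
  interpret N: real_distribution N by (fact N)
  obtain y where "G y < 1" "x < y"
    using assms(2) unfolding right_end_def less_Sup_iff by auto
  then show ?thesis
    using N.cdf_nondecreasing[of x y] by (simp add: N)
qed

lemma right_end_greater_MInfty:
  assumes "distribution_function G"
  shows "- \<infinity> < right_end G"
proof -
  obtain N where N: "real_distribution N" "G = cdf N"
    using assms unfolding distribution_function_def by blast
  interpret N: real_distribution N by (fact N)
  obtain x where "G x < 1"
    using order_tendstoD(2)[OF N.cdf_lim_at_bot, of 1] N
    by (auto simp: eventually_at_bot_linorder)
  then have "ereal x \<le> right_end G"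
    unfolding right_end_def by (intro Sup_upper) auto
  then show ?thesis
    by (cases "right_end G") auto
qed

text \<open>
  Without jumps the ratio of the tails is identically 1 below the right end. The limit 1 of \<open>G\<close>
  holds at a finite right end \<open>r\<close> because \<open>G\<close> equals 1 beyond \<open>r\<close> and hence, by continuity, at \<open>r\<close>.
\<close>
lemma continuous_imp_regular:
  assumes G: "distribution_function G" and cont: "continuous_on UNIV G"
  shows "regular_df G"
proof -
  obtain N where N: "real_distribution N" "G = cdf N"
    using G(1) unfolding distribution_function_def by blast
  interpret N: real_distribution N by (fact N)
  have cont_at: "(G \<longlongrightarrow> G x) (at x within S)" for x S
    using cont by (simp add: continuous_on_eq_continuous_at isCont_def)
      (metis Lim_at_imp_Lim_at_within)
  have left_limit: "left_limit G x = G x" for x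
    unfolding left_limit_def by (rule tendsto_Lim[OF _ cont_at]) simp
  let ?r = "right_end G"
  have below: "\<forall>\<^sub>F x in at_left_ereal ?r. ereal x < ?r"
    unfolding at_left_ereal_def
    by (rule eventually_filtercomapI) (simp add: eventually_at_filter)
  have "(G \<longlongrightarrow> 1) (at_left_ereal ?r)"
  proof (cases ?r)
    case (real r)
    have "1 \<le> G x" if "r < x" for x
    proof (rule ccontr)
      assume "\<not> 1 \<le> G x"
      then have "ereal x \<le> ?r"
        unfolding right_end_def by (intro Sup_upper) auto
      with real that show False by simp
    qed
    then have "\<forall>\<^sub>F x in at_right r. 1 \<le> G x"
      by (auto simp: eventually_at_right_field intro: exI[of _ "r + 1"])
    then have "1 \<le> G r"
      by (rule tendsto_lowerbound[OF cont_at]) simp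
    then have "G r = 1"
      using N.cdf_bounded_prob[of r] by (simp add: N)
    then show ?thesis
      using cont_at[of r "{..<r}"] by (simp add: real at_left_ereal_simps)
  next
    case PInf
    then show ?thesis
      using N.cdf_lim_at_top_prob by (simp add: N at_left_ereal_simps)
  next
    case MInf
    then show ?thesis
      using right_end_greater_MInfty[OF G] by simp
  qed
  moreover have "((\<lambda>x. (1 - left_limit G x) / (1 - G x)) \<longlongrightarrow> 1) (at_left_ereal ?r)"
  proof (rule tendsto_eventually)
    show "\<forall>\<^sub>F x in at_left_ereal ?r. (1 - left_limit G x) / (1 - G x) = 1"
      using below by eventually_elim (use less_one_below_right_end[OF G] in \<open>fastforce simp: left_limit\<close>)
  qed
  ultimately show ?thesis
    by (simp add: regular_df_def)
qed

text \<open>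
  The level is an infimum where \<open>G\<close> crosses \<open>p n = 1 - \<beta> / (n + \<beta> + 1)\<close>, so \<open>p n\<close> lies between the
  left limit and the value of \<open>G\<close> there. Regularity says that the tails at these two ends have
  ratio tending to 1, whence either one is asymptotic to \<open>1 - p n\<close>.
\<close>
lemma regular_levels:
  fixes G :: "real \<Rightarrow> real" and \<beta> :: real
  assumes G: "distribution_function G" "regular_df G" and \<beta>: "0 < \<beta>"
  obtains v where "incseq v" "\<And>n. 0 < G (v n)" "\<And>n. G (v n) < 1" "(\<lambda>n. n * (1 - G (v n))) \<longlonglongrightarrow> \<beta>"
proof -
  obtain N where N: "real_distribution N" "G = cdf N"
    using G(1) unfolding distribution_function_def by blast
  interpret N: real_distribution N by (fact N)
  let ?r = "right_end G"
  let ?F = "at_left_ereal ?r"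
  have G_mono: "G x \<le> G y" if "x \<le> y" for x y
    using N.cdf_nondecreasing[OF that] by (simp add: N)
  have left_limit: "(G \<longlongrightarrow> left_limit G x) (at_left x)" for x
    using N.cdf_at_left[of x] tendsto_Lim[OF _ N.cdf_at_left[of x]]
    by (simp add: left_limit_def N)

  \<comment> \<open>The extra \<open>\<beta> + 1\<close> keeps \<open>p n\<close> strictly between 0 and 1 for every \<open>n\<close>, including 0.\<close>
  define p where "p n = 1 - \<beta> / (n + \<beta> + 1)" for n :: nat
  have p_pos: "0 < p n" and p_less: "p n < 1" for n
    using \<beta> by (auto simp: p_def field_simps add_pos_nonneg)
  have p_mono: "p m \<le> p n" if "m \<le> n" for m n
    using \<beta> that by (auto simp: p_def intro!: divide_left_mono add_nonneg_pos mult_pos_pos)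
  have p_lim: "p \<longlonglongrightarrow> 1"
    unfolding p_def using \<beta> by real_asymp
  define v where "v n = Inf {x. p n \<le> G x}" for n
  \<comment> \<open>Since \<open>G\<close> tends to 1 from the left at its right end, every \<open>p n\<close> is reached strictly before it.\<close>
  have reach: "\<exists>x. ereal x < ?r \<and> p n < G x" for n
  proof -
    have "\<forall>\<^sub>F x in ?F. p n < G x"
      using G(2) p_less by (auto simp: regular_df_def intro: order_tendstoD)
    then obtain Q where Q: "eventually Q (at_left ?r)" "\<And>x. Q (ereal x) \<Longrightarrow> p n < G x"
      by (auto simp: at_left_ereal_def eventually_filtercomap)
    from Q(1) obtain b where b: "b < ?r" "\<And>y. b < y \<Longrightarrow> y < ?r \<Longrightarrow> Q y"
      using eventually_at_left[OF right_end_greater_MInfty[OF G(1)]] by auto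
    then show ?thesis
      using ereal_dense2[OF b(1)] Q(2) by blast
  qed
  have bdd: "bdd_below {x. p n \<le> G x}" for n
  proof -
    have "\<forall>\<^sub>F x in at_bot. G x < p n"
      using order_tendstoD(2)[OF N.cdf_lim_at_bot p_pos] by (simp add: N)
    then obtain z where "\<And>x. x \<le> z \<Longrightarrow> G x < p n"
      by (auto simp: eventually_at_bot_linorder)
    then show ?thesis
      by (intro bdd_belowI[of _ z]) (force simp flip: not_less)
  qed
  have v_le: "v n \<le> x" if "p n \<le> G x" for n x
    unfolding v_def using that bdd by (intro cInf_lower) auto
  have v_upper: "p n \<le> G (v n)" for n
  proof (rule tendsto_lowerbound)
    show "(G \<longlongrightarrow> G (v n)) (at_right (v n))"
      using N.cdf_is_right_cont[of "v n"] by (simp add: N continuous_within)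
    show "\<forall>\<^sub>F x in at_right (v n). p n \<le> G x"
      unfolding eventually_at_right_field
    proof (intro exI conjI allI impI)
      fix y assume "v n < y"
      moreover have "{x. p n \<le> G x} \<noteq> {}"
        using reach[of n] by (auto intro: less_imp_le)
      ultimately obtain x where "p n \<le> G x" "x < y"
        unfolding v_def using bdd by (auto simp: cInf_less_iff)
      then show "p n \<le> G y"
        using G_mono[of x y] by linarith
    qed (rule less_add_one)
  qed simp
  have v_lower: "left_limit G (v n) \<le> p n" for n
  proof (rule tendsto_upperbound[OF left_limit])
    have "G y \<le> p n" if "y < v n" for y
      by (rule ccontr) (use v_le[of n y] that in simp)
    then show "\<forall>\<^sub>F x in at_left (v n). G x \<le> p n"
      unfolding eventually_at_left_field by (intro exI[of _ "v n - 1"]) simp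
  qed simp
  have v_inc: "incseq v"
    unfolding incseq_def using v_le order_trans[OF p_mono v_upper] by blast
  have v_less_r: "ereal (v n) < ?r" for n
  proof -
    obtain x where "ereal x < ?r" "p n < G x"
      using reach by blast
    then show ?thesis
      using v_le[of n x] by (auto intro: le_less_trans[of _ "ereal x"])
  qed
  have "filterlim v ?F sequentially"
    unfolding at_left_ereal_def filterlim_filtercomap_iff filterlim_at
  proof (intro conjI always_eventually allI)
    show "((\<lambda>x. (ereal \<circ> v) x) \<longlongrightarrow> ?r) sequentially"
    proof (rule order_tendstoI)
      fix a assume "a < ?r"
      then obtain x where x: "a < ereal x" "G x < 1"
        unfolding right_end_def less_Sup_iff by auto
      have "\<forall>\<^sub>F n in sequentially. G x < p n"
        using order_tendstoD(1)[OF p_lim x(2)] .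
      then show "\<forall>\<^sub>F n in sequentially. a < (ereal \<circ> v) n"
      proof eventually_elim
        case (elim n)
        then have "x < v n"
          using v_upper[of n] G_mono[of "v n" x] by (metis leI less_le_trans linorder_not_le)
        with x(1) show ?case
          by (auto intro: less_trans)
      qed
    qed (use v_less_r in \<open>auto intro!: always_eventually intro: less_trans\<close>)
  qed (use v_less_r in \<open>auto simp: less_imp_neq\<close>)
  then have jump: "(\<lambda>n. (1 - left_limit G (v n)) / (1 - G (v n))) \<longlonglongrightarrow> 1"
    using G(2) unfolding regular_df_def by (auto intro: filterlim_compose)
  have less: "G (v n) < 1" for n
    using less_one_below_right_end[OF G(1) v_less_r] .
  have "(\<lambda>n. (1 - p n) / (1 - G (v n))) \<longlonglongrightarrow> 1"
  proof (rule tendsto_sandwich[OF _ _ tendsto_const jump])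
    show "\<forall>\<^sub>F n in sequentially. 1 \<le> (1 - p n) / (1 - G (v n))"
      using v_upper less by (intro always_eventually allI) (simp add: le_divide_eq)
    show "\<forall>\<^sub>F n in sequentially. (1 - p n) / (1 - G (v n)) \<le> (1 - left_limit G (v n)) / (1 - G (v n))"
      using v_lower less by (intro always_eventually allI divide_right_mono) (auto simp: less_imp_le)
  qed
  moreover have "(\<lambda>n. n * (1 - p n)) \<longlonglongrightarrow> \<beta>"
    unfolding p_def using \<beta> by real_asymp
  ultimately have "(\<lambda>n. n * (1 - p n) / ((1 - p n) / (1 - G (v n)))) \<longlonglongrightarrow> \<beta> / 1"
    by (intro tendsto_divide) auto
  moreover have "n * (1 - p n) / ((1 - p n) / (1 - G (v n))) = n * (1 - G (v n))" for n
    using p_less[of n] by simp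
  ultimately show thesis
    using that[OF v_inc less_le_trans[OF p_pos v_upper] less] by simp
qed

text \<open>
  The limit of \<open>(1 - y) ^ k\<close> for triangular \<open>y\<close> and \<open>k\<close>, by the bounds
  \<open>exp (- y / (1 - y)) \<le> 1 - y \<le> exp (- y)\<close>.
\<close>
lemma one_minus_power_tendsto:
  fixes y :: "nat \<Rightarrow> real" and k :: "nat \<Rightarrow> nat"
  assumes y: "\<And>n. 0 \<le> y n" "\<And>n. y n < 1" "y \<longlonglongrightarrow> 0" and lim: "(\<lambda>n. k n * y n) \<longlonglongrightarrow> c"
  shows "(\<lambda>n. (1 - y n) ^ k n) \<longlonglongrightarrow> exp (- c)"
proof (rule tendsto_sandwich)
  show "\<forall>\<^sub>F n in sequentially. exp (- (k n * y n / (1 - y n))) \<le> (1 - y n) ^ k n"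
  proof (intro always_eventually allI)
    fix n
    have "1 / (1 - y n) \<le> exp (y n / (1 - y n))"
      using exp_ge_add_one_self[of "y n / (1 - y n)"] y(2)[of n] by (simp add: field_simps)
    then have "exp (- (y n / (1 - y n))) \<le> 1 - y n"
      using y(2)[of n] by (simp add: exp_minus field_simps)
    then have "exp (- (y n / (1 - y n))) ^ k n \<le> (1 - y n) ^ k n"
      by (intro power_mono) auto
    then show "exp (- (k n * y n / (1 - y n))) \<le> (1 - y n) ^ k n"
      by (simp flip: exp_of_nat_mult)
  qed
  show "\<forall>\<^sub>F n in sequentially. (1 - y n) ^ k n \<le> exp (- (k n * y n))"
  proof (intro always_eventually allI)
    fix n
    have "(1 - y n) ^ k n \<le> exp (- y n) ^ k n"
      using exp_ge_add_one_self[of "- y n"] y(2)[of n] by (intro power_mono) auto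
    then show "(1 - y n) ^ k n \<le> exp (- (k n * y n))"
      by (simp flip: exp_of_nat_mult)
  qed
  have "(\<lambda>n. - (k n * y n / (1 - y n))) \<longlonglongrightarrow> - (c / (1 - 0))"
    by (intro tendsto_intros lim y) simp
  then show "(\<lambda>n. exp (- (k n * y n / (1 - y n)))) \<longlonglongrightarrow> exp (- c)"
    by (intro tendsto_exp) simp
  show "(\<lambda>n. exp (- (k n * y n))) \<longlonglongrightarrow> exp (- c)"
    by (intro tendsto_intros lim)
qed

lemma nat_floor_mult_over_tendsto:
  assumes "0 < (t::real)"
  shows "(\<lambda>n. nat \<lfloor>real n * t\<rfloor> / n) \<longlonglongrightarrow> t"
proof (rule tendsto_sandwich)
  show "(\<lambda>n. t - 1 / real n) \<longlonglongrightarrow> t"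
    by real_asymp
  show "\<forall>\<^sub>F n in sequentially. t - 1 / n \<le> nat \<lfloor>real n * t\<rfloor> / n"
    using eventually_gt_at_top[of 0]
  proof eventually_elim
    case (elim n)
    have "n * t - 1 \<le> nat \<lfloor>real n * t\<rfloor>" by linarith
    then have "(n * t - 1) / n \<le> nat \<lfloor>real n * t\<rfloor> / n"
      by (rule divide_right_mono) simp
    with elim show ?case by (simp add: diff_divide_distrib)
  qed
  show "\<forall>\<^sub>F n in sequentially. nat \<lfloor>real n * t\<rfloor> / n \<le> t"
    using eventually_gt_at_top[of 0]
  proof eventually_elim
    case (elim n)
    have "nat \<lfloor>real n * t\<rfloor> \<le> n * t"
      using assms by (simp add: of_nat_nat)
    with elim show ?case by (simp add: field_simps)
  qed
qed simp

lemma regular_phantom_levels: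
  assumes G: "distribution_function G" "regular_df G" and \<beta>: "0 < \<beta>"
    and phantom: "\<And>\<epsilon>. 0 < \<epsilon> \<Longrightarrow> \<forall>\<^sub>F n in sequentially. \<forall>x. \<bar>P n x - G x ^ n\<bar> \<le> \<epsilon>"
  obtains v where "incseq v"
    "\<And>t. 0 < t \<Longrightarrow> (\<lambda>n. P (nat \<lfloor>real n * t\<rfloor>) (v n)) \<longlonglongrightarrow> exp (- \<beta> * t)"
proof -
  obtain v where v: "incseq v" "\<And>n. 0 < G (v n)" "\<And>n. G (v n) < 1" "(\<lambda>n. n * (1 - G (v n))) \<longlonglongrightarrow> \<beta>"
    by (rule regular_levels[OF G \<beta>]) (rule that)
  have "(\<lambda>n. P (nat \<lfloor>real n * t\<rfloor>) (v n)) \<longlonglongrightarrow> exp (- \<beta> * t)" if t: "0 < t" for t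
  proof -
    let ?k = "\<lambda>n. nat \<lfloor>real n * t\<rfloor>"
    have k_top: "filterlim ?k at_top sequentially"
      using t by real_asymp
    have "(\<lambda>n. (1 - (1 - G (v n))) ^ ?k n) \<longlonglongrightarrow> exp (- (t * \<beta>))"
    proof (rule one_minus_power_tendsto)
      have "\<forall>\<^sub>F n in sequentially. n * (1 - G (v n)) / n = 1 - G (v n)"
        using eventually_gt_at_top[of 0] by eventually_elim simp
      moreover have "(\<lambda>n. n * (1 - G (v n)) / n) \<longlonglongrightarrow> 0"
        by (intro tendsto_divide_0[OF v(4)] filterlim_at_top_imp_at_infinity filterlim_real_sequentially)
      ultimately show "(\<lambda>n. 1 - G (v n)) \<longlonglongrightarrow> 0"
        by (rule Lim_transform_eventually[rotated])
      have "\<forall>\<^sub>F n in sequentially. (?k n / n) * (n * (1 - G (v n))) = ?k n * (1 - G (v n))"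
        using eventually_gt_at_top[of 0] by eventually_elim simp
      moreover have "(\<lambda>n. (?k n / n) * (n * (1 - G (v n)))) \<longlonglongrightarrow> t * \<beta>"
        by (intro tendsto_mult nat_floor_mult_over_tendsto v(4) t)
      ultimately show "(\<lambda>n. ?k n * (1 - G (v n))) \<longlonglongrightarrow> t * \<beta>"
        by (rule Lim_transform_eventually[rotated])
      show "1 - G (v n) < 1" for n
        using v(2)[of n] by simp
    qed (use v(3) in \<open>auto simp: less_imp_le\<close>)
    then have G_lim: "(\<lambda>n. G (v n) ^ ?k n) \<longlonglongrightarrow> exp (- \<beta> * t)"
      by (simp add: mult.commute)
    have "(\<lambda>n. P (?k n) (v n) - G (v n) ^ ?k n) \<longlonglongrightarrow> 0"
    proof (rule LIMSEQ_I)
      fix e :: real assume "0 < e"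
      then have ev: "\<forall>\<^sub>F n in sequentially. \<forall>x. \<bar>P n x - G x ^ n\<bar> \<le> e / 2"
        by (intro phantom) simp
      have "\<forall>\<^sub>F n in sequentially. \<forall>x. \<bar>P (?k n) x - G x ^ ?k n\<bar> \<le> e / 2"
        using filterlim_iff[THEN iffD1, OF k_top, rule_format, OF ev] .
      then have "\<forall>\<^sub>F n in sequentially. norm (P (?k n) (v n) - G (v n) ^ ?k n - 0) < e"
      proof eventually_elim
        case (elim n)
        then have "\<bar>P (?k n) (v n) - G (v n) ^ ?k n\<bar> \<le> e / 2" by blast
        then show ?case using \<open>0 < e\<close> by simp
      qed
      then show "\<exists>N. \<forall>n\<ge>N. norm (P (?k n) (v n) - G (v n) ^ ?k n - 0) < e"
        by (simp add: eventually_sequentially)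
    qed
    from tendsto_add[OF this G_lim] show ?thesis
      by simp
  qed
  with v(1) show thesis
    by (rule that)
qed

section \<open>Continuous interpolation between levels\<close>

text \<open>
  A function with \<open>h (v m) = u m\<close> need not exist when levels coincide. The last two conclusions,
  with \<open>a\<close> the first index of the block of \<open>m\<close>, say that \<open>h (v m)\<close> lies between the values of \<open>u\<close> at
  the index \<open>m\<close> itself and at the beginning of its block.

  The function is a sum of continuous ramps: the decrease from \<open>u n\<close> to \<open>u (Suc n)\<close> is spread over
  the interval from \<open>v n\<close> to the next strictly larger level. The ramps with index at least \<open>m\<close> are
  still at full height at \<open>v m\<close> and telescope to \<open>u m\<close>, and those of smaller levels have vanished.
  The sum converges uniformly because \<open>u\<close> tends to 0.
\<close>
lemma continuous_interpolation:
  fixes u v :: "nat \<Rightarrow> real"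
  assumes v: "incseq v" "\<And>n. \<exists>k. v n < v k"
    and u: "decseq u" "u \<longlonglongrightarrow> 0"
  obtains h where "continuous_on UNIV h" "antimono h" "\<And>x. 0 \<le> h x"
    "filterlim h at_top at_bot" "(h \<longlongrightarrow> 0) at_top"
    "\<And>m. u m \<le> h (v m)" "\<And>a m. (\<And>n. n < a \<Longrightarrow> v n < v m) \<Longrightarrow> h (v m) \<le> u a"
proof -
  define s where "s n = (LEAST k. v n < v k)" for n
  have s_gt: "v n < v (s n)" for n
    unfolding s_def using v(2) by (rule LeastI_ex)
  have s_le: "v (s n) \<le> v m" if "v n < v m" for n m
    using v(1) Least_le[of "\<lambda>k. v n < v k", OF that] unfolding s_def incseq_def by blast
  define \<psi> where "\<psi> n x = max 0 (min 1 ((v (s n) - x) / (v (s n) - v n)))" for n x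
  have \<psi>_cont: "continuous_on UNIV (\<psi> n)" for n
    unfolding \<psi>_def by (intro continuous_intros) (use s_gt[of n] in auto)
  have \<psi>_bounds: "0 \<le> \<psi> n x" "\<psi> n x \<le> 1" for n x
    unfolding \<psi>_def by auto
  have \<psi>_anti: "\<psi> n y \<le> \<psi> n x" if "x \<le> y" for n x y
    unfolding \<psi>_def using s_gt[of n] that
    by (intro max.mono min.mono order_refl divide_right_mono) auto
  have \<psi>_one: "\<psi> n x = 1" if "x \<le> v n" for n x
    using s_gt[of n] that by (simp add: \<psi>_def min_def max_def divide_simps)
  have \<psi>_zero: "\<psi> n x = 0" if "v (s n) \<le> x" for n x
    using s_gt[of n] that by (simp add: \<psi>_def max_def min_def divide_simps)

  define c where "c n = u n - u (Suc n)" for n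
  have c_nonneg: "0 \<le> c n" for n
    using u(1) by (simp add: c_def decseq_Suc_iff)
  have c_sums: "(\<lambda>n. c (n + m)) sums u m" for m
    using telescope_sums'[of "\<lambda>n. u (n + m)" 0] LIMSEQ_ignore_initial_segment[OF u(2)]
    by (simp add: c_def)
  have c_summable: "summable c"
    using c_sums[of 0] by (simp add: sums_iff)
  define g where "g x = (\<Sum>n. c n * \<psi> n x)" for x
  have term_bounds: "0 \<le> c n * \<psi> n x" "c n * \<psi> n x \<le> c n" for n x
    using c_nonneg[of n] \<psi>_bounds[of n x] by (auto intro: mult_left_le)
  have g_summable: "summable (\<lambda>n. c n * \<psi> n x)" for x
    by (rule summable_comparison_test'[OF c_summable, of 0]) (use term_bounds in auto)
  have g_nonneg: "0 \<le> g x" for x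
    unfolding g_def by (intro suminf_nonneg g_summable term_bounds)
  have g_anti: "g y \<le> g x" if "x \<le> y" for x y
    unfolding g_def using that
    by (intro suminf_le g_summable mult_left_mono \<psi>_anti c_nonneg)
  have g_cont: "continuous_on UNIV g"
    unfolding g_def
  proof (rule uniform_limit_theorem[OF _ Weierstrass_m_test[OF _ c_summable]])
    show "\<forall>\<^sub>F n in sequentially. continuous_on UNIV (\<lambda>x. \<Sum>i<n. c i * \<psi> i x)"
      by (intro always_eventually allI continuous_intros \<psi>_cont)
  qed (use term_bounds in auto)
  have g_split: "g x = (\<Sum>n. c (n + a) * \<psi> (n + a) x) + (\<Sum>n<a. c n * \<psi> n x)" for x a
    unfolding g_def by (rule suminf_split_initial_segment[OF g_summable])
  have g_lower: "u m \<le> g (v m)" for m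
  proof -
    have "\<psi> (n + m) (v m) = 1" for n
      using v(1) by (intro \<psi>_one) (simp add: incseq_def)
    then have "g (v m) = u m + (\<Sum>n<m. c n * \<psi> n (v m))"
      using c_sums[of m] by (simp add: g_split[of _ m] sums_iff)
    then show ?thesis
      using term_bounds by (simp add: sum_nonneg)
  qed
  have g_upper: "g (v m) \<le> u a" if "\<And>n. n < a \<Longrightarrow> v n < v m" for a m
  proof -
    have "(\<Sum>n<a. c n * \<psi> n (v m)) = 0"
      using that s_le \<psi>_zero by (intro sum.neutral) auto
    moreover have "(\<Sum>n. c (n + a) * \<psi> (n + a) (v m)) \<le> (\<Sum>n. c (n + a))"
      using c_sums[of a]
      by (intro suminf_le term_bounds summable_ignore_initial_segment[OF g_summable])
         (auto simp: sums_iff)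
    ultimately show ?thesis
      using c_sums[of a] by (simp add: g_split[of _ a] sums_iff)
  qed

  \<comment> \<open>The sum is bounded by \<open>u 0\<close>; the correction to the left of all levels makes \<open>h\<close> unbounded there.\<close>
  define h where "h x = g x + max 0 (v 0 - x)" for x
  have h_level: "h (v m) = g (v m)" for m
    using v(1) by (simp add: h_def incseq_def)
  have h_anti: "h y \<le> h x" if "x \<le> y" for x y
    using g_anti[OF that] that unfolding h_def by (intro add_mono max.mono) auto
  have h_nonneg: "0 \<le> h x" for x
    using g_nonneg[of x] by (simp add: h_def)
  show thesis
  proof
    show "continuous_on UNIV h"
      unfolding h_def by (intro continuous_intros g_cont)
    show "antimono h"
      using h_anti by (simp add: antimono_def)
    show "0 \<le> h x" for x by (rule h_nonneg)
    show "filterlim h at_top at_bot"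
    proof (rule filterlim_at_top_mono)
      show "filterlim (\<lambda>x. v 0 + - x) at_top at_bot"
        by (intro filterlim_tendsto_add_at_top[OF tendsto_const] filterlim_uminus_at_top_at_bot)
      show "\<forall>\<^sub>F x in at_bot. v 0 + - x \<le> h x"
        using g_nonneg by (auto intro!: always_eventually simp: h_def intro: add_increasing)
    qed
    show "u m \<le> h (v m)" for m
      by (simp add: h_level g_lower)
    show upper: "h (v m) \<le> u a" if "\<And>n. n < a \<Longrightarrow> v n < v m" for a m
      using g_upper[OF that] by (simp add: h_level)
    show "(h \<longlongrightarrow> 0) at_top"
    proof (rule order_tendstoI)
      fix e :: real assume "0 < e"
      then obtain a where a: "u a < e"
        using order_tendstoD(2)[OF u(2)] by (auto simp: eventually_sequentially)
      obtain k where "v a < v k"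
        using v(2) by blast
      then have below: "v n < v k" if "n < a" for n
        using v(1) that by (meson incseqD less_imp_le le_less_trans)
      have "h (v k) \<le> u a"
        using below by (rule upper)
      then have "h x < e" if "v k \<le> x" for x
        using h_anti[OF that] a by linarith
      then show "\<forall>\<^sub>F x in at_top. h x < e"
        by (auto simp: eventually_at_top_linorder)
    qed (use h_nonneg in \<open>auto intro!: always_eventually intro: less_le_trans\<close>)
  qed
qed

section \<open>From levels to a continuous phantom distribution function\<close>

text \<open>
  A bound by the relative distance of the exponents, uniform in their size: it compares
  \<open>exp (- \<beta> * n / k)\<close> for nearby \<open>k\<close> simultaneously for all \<open>n\<close>. The factor \<open>exp (- a) \<le> 1 / a\<close>
  turns the absolute distance into the relative one.
\<close>
lemma exp_minus_diff_le:
  fixes a b :: real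
  assumes "0 < a" "a \<le> b"
  shows "exp (- a) - exp (- b) \<le> b / a - 1"
proof -
  have "exp (- b) = exp (- a) * exp (a - b)"
    by (simp add: mult_exp_exp)
  moreover have "1 - exp (a - b) \<le> b - a"
    using exp_ge_add_one_self[of "a - b"] by linarith
  then have "exp (- a) * (1 - exp (a - b)) \<le> exp (- a) * (b - a)"
    by (rule mult_left_mono) simp
  ultimately have "exp (- a) - exp (- b) \<le> exp (- a) * (b - a)"
    by (simp add: right_diff_distrib)
  also have "\<dots> \<le> (1 / a) * (b - a)"
  proof (rule mult_right_mono)
    have "a \<le> exp a"
      using exp_ge_add_one_self[of a] by linarith
    then show "exp (- a) \<le> 1 / a"
      using assms by (simp add: exp_minus field_simps)
  qed (use assms in simp)
  also have "\<dots> = b / a - 1"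
    using assms by (simp add: field_simps)
  finally show ?thesis .
qed

text \<open>
  The monotonicity laws are asked for \<open>n \<ge> 1\<close> only, since the maximum of an empty family is an
  arbitrary number.
\<close>
locale maximum_laws =
  fixes P :: "nat \<Rightarrow> real \<Rightarrow> real"
  assumes nonneg: "0 \<le> P n x" and le_one: "P n x \<le> 1"
    and mono_level: "1 \<le> n \<Longrightarrow> x \<le> y \<Longrightarrow> P n x \<le> P n y"
    and anti_index: "1 \<le> m \<Longrightarrow> m \<le> n \<Longrightarrow> P n x \<le> P m x"
begin

text \<open>
  Polya's argument. For large \<open>K\<close> pick a time \<open>\<tau> i\<close> in the dense set \<open>D\<close> for each band of values
  \<open>{i / K<..<(i + 1) / K}\<close> of \<open>exp (- \<beta> * t)\<close>. For large \<open>k\<close> the approximation is good at these finitely many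
  times, and for \<open>t = n / k\<close> with value in band \<open>i\<close>, monotonicity in the index traps \<open>P n (v k)\<close>
  between its values at the times of the bands \<open>i - 1\<close> and \<open>i + 1\<close>; at the outermost bands the bounds
  0 and 1 replace the missing times.
\<close>
lemma uniform_in_index:
  fixes v :: "nat \<Rightarrow> real"
  assumes "0 < \<beta>" and D: "D \<subseteq> {0<..}" "{0<..} \<subseteq> closure D"
    and conv: "\<And>t. t \<in> D \<Longrightarrow> (\<lambda>n. P (nat \<lfloor>real n * t\<rfloor>) (v n)) \<longlonglongrightarrow> exp (- \<beta> * t)"
    and "0 < \<epsilon>"
  shows "\<forall>\<^sub>F k in sequentially. \<forall>n\<ge>1. \<bar>P n (v k) - exp (- (\<beta> * n / k))\<bar> \<le> \<epsilon>"
proof -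
  obtain K :: nat where K: "3 / \<epsilon> < K"
    using reals_Archimedean2 by blast
  moreover have "0 < 3 / \<epsilon>"
    using \<open>0 < \<epsilon>\<close> by simp
  ultimately have "0 < K"
    by (metis of_nat_0_less_iff less_trans)
  with K have K_eps: "3 / K < \<epsilon>"
    using \<open>0 < \<epsilon>\<close> by (simp add: field_simps)
  have "\<exists>t\<in>D. i < K * exp (- \<beta> * t) \<and> K * exp (- \<beta> * t) < real i + 1" if "i < K" for i :: nat
  proof -
    let ?S = "{t. i < K * exp (- \<beta> * t) \<and> K * exp (- \<beta> * t) < real i + 1}"
    \<comment> \<open>The time at which \<open>exp (- \<beta> * t)\<close> passes the middle of the band.\<close>
    define s where "s = - ln ((i + 1/2) / K) / \<beta>"
    have "real i + 1/2 < K"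
      using that by linarith
    then have "s > 0"
      using \<open>0 < \<beta>\<close> \<open>0 < K\<close> by (simp add: s_def divide_neg_pos)
    moreover have "K * exp (- \<beta> * s) = i + 1/2"
      using \<open>0 < \<beta>\<close> \<open>0 < K\<close> by (simp add: s_def)
    ultimately have "s \<in> ?S \<inter> closure D"
      using D(2) by auto
    moreover have "open ?S"
      by (intro open_Collect_conj open_Collect_less continuous_intros)
    ultimately have "?S \<inter> D \<noteq> {}"
      using open_Int_closure_eq_empty by blast
    then show ?thesis by auto
  qed
  then obtain \<tau> where \<tau>: "\<And>i. i < K \<Longrightarrow> \<tau> i \<in> D" 
      "\<And>i. i < K \<Longrightarrow> i < K * exp (- \<beta> * \<tau> i)" 
      "\<And>i. i < K \<Longrightarrow> K * exp (- \<beta> * \<tau> i) < real i + 1"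
    by metis
  have "\<forall>\<^sub>F k in sequentially. \<forall>i\<in>{..<K}.
      \<bar>P (nat \<lfloor>real k * \<tau> i\<rfloor>) (v k) - exp (- \<beta> * \<tau> i)\<bar> < 1 / K \<and> 1 \<le> real k * \<tau> i"
  proof (intro eventually_ball_finite ballI eventually_conj)
    fix i assume i: "i \<in> {..<K}"
    then have "\<tau> i \<in> D" using \<tau> by simp
    with D(1) have "0 < \<tau> i" by auto
    show "\<forall>\<^sub>F k in sequentially. \<bar>P (nat \<lfloor>real k * \<tau> i\<rfloor>) (v k) - exp (- \<beta> * \<tau> i)\<bar> < 1 / K"
      using tendstoD[OF conv[OF \<open>\<tau> i \<in> D\<close>], of "1 / K"] \<open>0 < K\<close> by (simp add: dist_real_def)
    have "filterlim (\<lambda>k. real k * \<tau> i) at_top sequentially"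
      using \<open>0 < \<tau> i\<close>
      by (intro filterlim_at_top_mult_tendsto_pos[OF tendsto_const _ filterlim_real_sequentially])
    then show "\<forall>\<^sub>F k in sequentially. 1 \<le> real k * \<tau> i"
      by (simp add: filterlim_at_top)
  qed simp
  then show ?thesis
    using eventually_gt_at_top[of 0]
  proof eventually_elim
    case (elim k)
    show ?case
    proof (intro allI impI)
      fix n :: nat assume "1 \<le> n"
      define t where "t = n / k"
      define i where "i = nat \<lfloor>K * exp (- \<beta> * t)\<rfloor>"
      have "0 < t" and n_eq: "n = k * t"
        using \<open>1 \<le> n\<close> elim(2) by (auto simp: t_def)
      have "K * exp (- \<beta> * t) < K"
        using \<open>0 < t\<close> \<open>0 < \<beta>\<close> \<open>0 < K\<close> by simp
      moreover have i: "i \<le> K * exp (- \<beta> * t)" "K * exp (- \<beta> * t) < i + 1"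
        unfolding i_def by (simp_all add: of_nat_nat) linarith
      ultimately have "i < K" by linarith
      have less_iff: "t < r \<longleftrightarrow> K * exp (- \<beta> * r) < K * exp (- \<beta> * t)" for r
        using \<open>0 < \<beta>\<close> \<open>0 < K\<close> by simp
      have gt_iff: "r < t \<longleftrightarrow> K * exp (- \<beta> * t) < K * exp (- \<beta> * r)" for r
        using \<open>0 < \<beta>\<close> \<open>0 < K\<close> by simp
      have close: "K * P (nat \<lfloor>real k * \<tau> j\<rfloor>) (v k) < real j + 2"
        "real j - 1 < K * P (nat \<lfloor>real k * \<tau> j\<rfloor>) (v k)" "1 \<le> nat \<lfloor>real k * \<tau> j\<rfloor>" if "j < K" for j :: nat
      proof -
        have "\<bar>P (nat \<lfloor>real k * \<tau> j\<rfloor>) (v k) - exp (- \<beta> * \<tau> j)\<bar> < 1 / K" "1 \<le> real k * \<tau> j"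
          using elim(1) that by auto
        then have "\<bar>K * P (nat \<lfloor>real k * \<tau> j\<rfloor>) (v k) - K * exp (- \<beta> * \<tau> j)\<bar> < 1"
          using \<open>0 < K\<close> by (simp add: field_simps abs_if split: if_splits)
        with \<tau>(2,3)[OF that] show "K * P (nat \<lfloor>real k * \<tau> j\<rfloor>) (v k) < real j + 2"
          "real j - 1 < K * P (nat \<lfloor>real k * \<tau> j\<rfloor>) (v k)" by linarith+
        show "1 \<le> nat \<lfloor>real k * \<tau> j\<rfloor>"
          using \<open>1 \<le> real k * \<tau> j\<close> by (simp add: le_nat_iff)
      qed
      have upper: "K * P n (v k) \<le> K * exp (- \<beta> * t) + 3"
      proof (cases "i + 1 < K")
        case True
        have "\<tau> (i + 1) < t"
          using \<tau>(2)[OF True] i(2) unfolding gt_iff by simp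
        then have "real k * \<tau> (i + 1) \<le> n"
          using elim(2) by (simp add: n_eq)
        then have "nat \<lfloor>real k * \<tau> (i + 1)\<rfloor> \<le> n"
          by linarith
        then have "K * P n (v k) \<le> K * P (nat \<lfloor>real k * \<tau> (i + 1)\<rfloor>) (v k)"
          using close(3)[OF True] by (intro mult_left_mono anti_index) auto
        with close(1)[OF True] i show ?thesis by simp
      next
        case False
        then have "real K \<le> i + 1" by linarith
        moreover have "K * P n (v k) \<le> K"
          by (simp add: le_one mult_left_le)
        ultimately show ?thesis using i by linarith
      qed
      have lower: "K * exp (- \<beta> * t) - 3 \<le> K * P n (v k)"
      proof (cases "i = 0")
        case True
        have "0 \<le> K * P n (v k)"
          by (simp add: nonneg)
        then show ?thesis using i(2) True by simp
      next
        case False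
        with \<open>i < K\<close> have less: "i - 1 < K" and pred: "real (i - 1) = real i - 1" by auto
        have "t < \<tau> (i - 1)"
          using \<tau>(3)[OF less] i(1) pred unfolding less_iff by simp
        then have "n \<le> real k * \<tau> (i - 1)"
          using elim(2) by (simp add: n_eq)
        then have "n \<le> nat \<lfloor>real k * \<tau> (i - 1)\<rfloor>"
          by linarith
        then have "K * P (nat \<lfloor>real k * \<tau> (i - 1)\<rfloor>) (v k) \<le> K * P n (v k)"
          using \<open>1 \<le> n\<close> by (intro mult_left_mono anti_index) auto
        with close(2)[OF less] i(2) pred show ?thesis by linarith
      qed
      have "\<bar>P n (v k) - exp (- \<beta> * t)\<bar> \<le> 3 / K"
        using upper lower \<open>0 < K\<close> by (simp add: field_simps abs_le_iff)
      then show "\<bar>P n (v k) - exp (- (\<beta> * n / k))\<bar> \<le> \<epsilon>"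
        using K_eps by (simp add: t_def)
    qed
  qed
qed

context
  fixes v :: "nat \<Rightarrow> real" and \<beta> :: real
  assumes \<beta>: "0 < \<beta>" and v: "incseq v"
    and levels: "\<And>\<epsilon>. 0 < \<epsilon> \<Longrightarrow>
      \<forall>\<^sub>F k in sequentially. \<forall>n\<ge>1. \<bar>P n (v k) - exp (- (\<beta> * n / k))\<bar> \<le> \<epsilon>"
begin

text \<open>
  If all levels from \<open>n\<close> on were equal, \<open>P k (v n)\<close> would be close both to \<open>exp (- \<beta>)\<close>, reading
  \<open>v n\<close> as \<open>v k\<close>, and to \<open>exp (- \<beta> / 2)\<close>, reading it as \<open>v (2 * k)\<close>.
\<close>
lemma not_eventually_constant: "\<exists>k. v n < v k"
proof (rule ccontr)
  assume "\<not> ?thesis"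
  then have const: "v k = v n" if "n \<le> k" for k
    using incseqD[OF v that] by (auto simp: not_less intro: antisym)
  define \<epsilon> where "\<epsilon> = (exp (- (\<beta> / 2)) - exp (- \<beta>)) / 3"
  have "0 < \<epsilon>"
    using \<beta> by (simp add: \<epsilon>_def)
  obtain N where N: "\<And>k m. N \<le> k \<Longrightarrow> 1 \<le> m \<Longrightarrow> \<bar>P m (v k) - exp (- (\<beta> * m / k))\<bar> \<le> \<epsilon>"
    using levels[OF \<open>0 < \<epsilon>\<close>] by (auto simp: eventually_sequentially)
  define k where "k = N + n + 1"
  have "\<bar>P k (v n) - exp (- \<beta>)\<bar> \<le> \<epsilon>" "\<bar>P k (v n) - exp (- (\<beta> / 2))\<bar> \<le> \<epsilon>"
  proof -
    have "0 < k" "n \<le> k" "n \<le> 2 * k" "N \<le> k" "N \<le> 2 * k" "1 \<le> k"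
      by (auto simp: k_def)
    moreover from \<open>0 < k\<close> have "\<beta> * k / k = \<beta>" "\<beta> * k / real (2 * k) = \<beta> / 2"
      by auto
    ultimately show "\<bar>P k (v n) - exp (- \<beta>)\<bar> \<le> \<epsilon>" "\<bar>P k (v n) - exp (- (\<beta> / 2))\<bar> \<le> \<epsilon>"
      using N[of k k] N[of "2 * k" k] const[of k] const[of "2 * k"] by metis+
  qed
  then show False
    using \<open>0 < \<epsilon>\<close> unfolding \<epsilon>_def by argo
qed

definition first_index :: "nat \<Rightarrow> nat" where
  "first_index m = (LEAST k. v k = v m)"

lemma level_first_index: "v (first_index m) = v m"
  unfolding first_index_def by (rule LeastI) simp

lemma level_less_of_less_first_index:
  assumes "n < first_index m"
  shows "v n < v m"
proof -
  have "v n \<le> v m"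
    using incseqD[OF v, of n "first_index m"] assms by (simp add: level_first_index)
  moreover have "v n \<noteq> v m"
    using assms not_less_Least unfolding first_index_def by blast
  ultimately show ?thesis by simp
qed

lemma first_index_le: "first_index m \<le> m"
  unfolding first_index_def by (rule Least_le) simp

lemma first_index_at_top: "filterlim first_index at_top sequentially"
  unfolding filterlim_at_top
proof
  fix N
  obtain k where k: "v N < v k"
    using not_eventually_constant by blast
  have "N \<le> first_index m" if "k \<le> m" for m
  proof (rule ccontr)
    assume "\<not> N \<le> first_index m"
    then have "v m \<le> v N"
      using incseqD[OF v, of "first_index m" N] by (simp add: level_first_index)
    with incseqD[OF v that] k show False by linarith
  qed
  then show "\<forall>\<^sub>F m in sequentially. N \<le> first_index m"
    by (auto simp: eventually_sequentially)
qed

text \<open>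
  With \<open>a\<close> the first index of the block of \<open>m\<close>, the probability \<open>P a (v m)\<close> is close to
  \<open>exp (- \<beta> * a / m)\<close> by the approximation at the index \<open>m\<close>, and to \<open>exp (- \<beta>)\<close> by the one at \<open>a\<close>.
\<close>
lemma index_ratio_tendsto: "(\<lambda>m. m / first_index m) \<longlonglongrightarrow> 1"
proof -
  have "(\<lambda>m. exp (- (\<beta> * first_index m / m))) \<longlonglongrightarrow> exp (- \<beta>)"
  proof (rule LIMSEQ_I)
    fix e :: real assume "0 < e"
    then have ev: "\<forall>\<^sub>F k in sequentially. \<forall>n\<ge>1. \<bar>P n (v k) - exp (- (\<beta> * n / k))\<bar> \<le> e / 3"
      by (intro levels) simp
    have "\<forall>\<^sub>F m in sequentially. norm (exp (- (\<beta> * first_index m / m)) - exp (- \<beta>)) < e"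
      using ev filterlim_iff[THEN iffD1, OF first_index_at_top, rule_format, OF ev]
        filterlim_at_top[THEN iffD1, OF first_index_at_top, rule_format, of 1]
    proof eventually_elim
      case (elim m)
      have "\<bar>P (first_index m) (v m) - exp (- (\<beta> * first_index m / m))\<bar> \<le> e / 3"
        using elim by blast
      moreover have "\<bar>P (first_index m) (v m) - exp (- \<beta>)\<bar> \<le> e / 3"
        using elim(2)[rule_format, OF elim(3)] elim(3) by (simp add: level_first_index)
      ultimately show ?case
        using \<open>0 < e\<close> unfolding real_norm_def by argo
    qed
    then show "\<exists>N. \<forall>m\<ge>N. norm (exp (- (\<beta> * first_index m / m)) - exp (- \<beta>)) < e"
      by (simp add: eventually_sequentially)
  qed
  from tendsto_ln[OF this] have "(\<lambda>m. - (\<beta> * first_index m / m)) \<longlonglongrightarrow> - \<beta>"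
    by simp
  from tendsto_divide[OF this tendsto_const, of "- \<beta>"]
  have "(\<lambda>m. first_index m / m) \<longlonglongrightarrow> 1"
    using \<beta> by simp
  from tendsto_inverse[OF this] show ?thesis
    by simp
qed

text \<open>
  Take \<open>G = exp (- h)\<close> for the interpolation \<open>h\<close> of \<open>\<beta> / (n + 1)\<close>. For \<open>x\<close> in an interval
  \<open>{v k..<v (k + 1)}\<close> with \<open>k\<close> large, both \<open>P n x\<close> and \<open>G x ^ n\<close> lie, up to \<open>\<delta>\<close>, between
  \<open>exp (- \<beta> * n / a)\<close> and \<open>exp (- \<beta> * n / (k + 2))\<close>, where \<open>a\<close> is the first index of the block of
  \<open>k\<close>; these bounds are close, uniformly in \<open>n\<close>, because \<open>(k + 2) / a\<close> is near 1. Above all levels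
  both functions are near 1. Below a fixed level both tend to 0 as \<open>n\<close> grows, and only this part
  requires \<open>n\<close> to be large.
\<close>
lemma continuous_phantom:
  obtains G where "continuous_on UNIV G" "distribution_function G"
    "\<And>\<epsilon>. 0 < \<epsilon> \<Longrightarrow> \<forall>\<^sub>F n in sequentially. \<forall>x. \<bar>P n x - G x ^ n\<bar> \<le> \<epsilon>"
proof -
  define u where "u n = \<beta> / (n + 1)" for n :: nat
  have u: "decseq u" "u \<longlonglongrightarrow> 0"
  proof -
    show "decseq u"
      using \<beta> by (auto simp: u_def decseq_def intro!: divide_left_mono)
    show "u \<longlonglongrightarrow> 0"
      unfolding u_def by real_asymp
  qed
  obtain h where h: "continuous_on UNIV h" "antimono h" "\<And>x. 0 \<le> h x"
    "filterlim h at_top at_bot" "(h \<longlongrightarrow> 0) at_top" "\<And>m. u m \<le> h (v m)"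
    "\<And>a m. (\<And>n. n < a \<Longrightarrow> v n < v m) \<Longrightarrow> h (v m) \<le> u a"
    using continuous_interpolation[OF v not_eventually_constant u] by blast
  define G where "G x = exp (- h x)" for x
  have G_mono: "G x \<le> G y" if "x \<le> y" for x y
    using antimonoD[OF h(2) that] by (simp add: G_def)
  have G_cont: "continuous_on UNIV G"
    unfolding G_def by (intro continuous_intros h(1))
  have G_right_cont: "continuous (at_right a) G" for a
    using G_cont by (auto simp: continuous_on_eq_continuous_at intro: continuous_at_imp_continuous_within)
  have G_bot: "(G \<longlongrightarrow> 0) at_bot"
    unfolding G_def
    by (rule filterlim_compose[OF exp_at_bot]) (use h(4) in \<open>simp add: filterlim_uminus_at_bot\<close>)
  have G_top: "(G \<longlongrightarrow> 1) at_top"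
    using tendsto_exp[OF tendsto_minus[OF h(5)]] unfolding G_def by simp
  have "distribution_function G"
    unfolding distribution_function_def
    using real_distribution_interval_measure[OF G_mono G_right_cont G_bot G_top]
      cdf_interval_measure[OF G_mono G_right_cont G_bot] by metis
  moreover have "\<forall>\<^sub>F n in sequentially. \<forall>x. \<bar>P n x - G x ^ n\<bar> \<le> \<epsilon>" if "0 < \<epsilon>" for \<epsilon>
  proof -
    define \<delta> where "\<delta> = \<epsilon> / 2"
    have "0 < \<delta>" using that by (simp add: \<delta>_def)
    let ?e = "\<lambda>(n::nat) (k::nat). exp (- (\<beta> * n / k))"
    let ?a = first_index
    have e_mono: "?e n k \<le> ?e n l" if "1 \<le> k" "k \<le> l" for n k l
      using that \<beta> by (auto intro!: divide_left_mono mult_nonneg_nonneg)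
    have e_width: "?e n l - ?e n k \<le> l / k - 1" if "1 \<le> n" "1 \<le> k" "k \<le> l" for n k l
    proof -
      have "(\<beta> * n / k) / (\<beta> * n / l) = l / k"
        using that \<beta> by (simp add: field_simps)
      then show ?thesis
        using exp_minus_diff_le[of "\<beta> * n / l" "\<beta> * n / k"] that \<beta>
        by (simp add: divide_left_mono)
    qed
    have G_power: "G x ^ n = exp (- (n * h x))" for n x
      by (simp add: G_def flip: exp_of_nat_mult)
    have G_bounds: "0 \<le> G x ^ n" "G x ^ n \<le> 1" for n x
      using h(3)[of x] by (auto simp: G_power)
    have ratio: "(\<lambda>m. (m + 2) / ?a m) \<longlonglongrightarrow> 1"
    proof -
      have "(\<lambda>m. ((m + 2) / m) * (m / ?a m)) \<longlonglongrightarrow> 1 * 1"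
        by (intro tendsto_mult index_ratio_tendsto) real_asymp
      moreover have "\<forall>\<^sub>F m in sequentially. ((m + 2) / m) * (m / ?a m) = (m + 2) / ?a m"
        using eventually_gt_at_top[of 0] by eventually_elim simp
      ultimately have "(\<lambda>m. (m + 2) / ?a m) \<longlonglongrightarrow> 1 * 1"
        by (rule Lim_transform_eventually)
      then show ?thesis
        by simp
    qed
    have "\<forall>\<^sub>F m in sequentially. (\<forall>n\<ge>1. \<bar>P n (v m) - ?e n m\<bar> \<le> \<delta>) \<and>
        (\<forall>n\<ge>1. \<bar>P n (v (?a m)) - ?e n (?a m)\<bar> \<le> \<delta>) \<and> (m + 2) / ?a m < 1 + \<delta> \<and> 1 \<le> ?a m"
      using levels[OF \<open>0 < \<delta>\<close>] 
        filterlim_iff[THEN iffD1, OF first_index_at_top, rule_format, OF levels[OF \<open>0 < \<delta>\<close>]]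
        order_tendstoD(2)[OF ratio, of "1 + \<delta>"]
        filterlim_at_top[THEN iffD1, OF first_index_at_top, rule_format, of 1] \<open>0 < \<delta>\<close>
      by (intro eventually_conj) simp_all
    then obtain m0 where m0: "\<And>m n. m0 \<le> m \<Longrightarrow> 1 \<le> n \<Longrightarrow> \<bar>P n (v m) - ?e n m\<bar> \<le> \<delta>"
      "\<And>m n. m0 \<le> m \<Longrightarrow> 1 \<le> n \<Longrightarrow> \<bar>P n (v m) - ?e n (?a m)\<bar> \<le> \<delta>"
      "\<And>m. m0 \<le> m \<Longrightarrow> (m + 2) / ?a m < 1 + \<delta>" "\<And>m. m0 \<le> m \<Longrightarrow> 1 \<le> ?a m"
      by (auto simp: eventually_sequentially level_first_index add.commute)
    have lower: "?e n (?a k) - \<delta> \<le> P n x" "?e n (?a k) \<le> G x ^ n"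
      if "m0 \<le> k" "1 \<le> n" "v k \<le> x" for n k x
    proof -
      show "?e n (?a k) - \<delta> \<le> P n x"
        using m0(2)[OF that(1,2)] mono_level[OF that(2,3)] by linarith
      have "h x \<le> u (?a k)"
        using antimonoD[OF h(2) that(3)] h(7)[of "?a k" k, OF level_less_of_less_first_index]
        by linarith
      also have "\<dots> \<le> \<beta> / ?a k"
        unfolding u_def using m0(4)[OF that(1)] \<beta> by (intro divide_left_mono) auto
      finally have "n * h x \<le> n * (\<beta> / ?a k)"
        by (intro mult_left_mono) auto
      then show "?e n (?a k) \<le> G x ^ n"
        unfolding G_power by (simp add: mult.commute)
    qed
    have upper: "P n x \<le> ?e n (k + 1) + \<delta>" "G x ^ n \<le> ?e n (k + 1)"
      if "m0 \<le> k" "1 \<le> n" "x \<le> v k" "1 \<le> k" for n k x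
    proof -
      show "P n x \<le> ?e n (k + 1) + \<delta>"
        using m0(1)[OF that(1,2)] mono_level[OF that(2,3)] e_mono[OF that(4), of "k + 1" n]
        by linarith
      have "u k \<le> h x"
        using antimonoD[OF h(2) that(3)] h(6)[of k] by linarith
      then have "n * (\<beta> / (k + 1)) \<le> n * h x"
        unfolding u_def by (intro mult_left_mono) auto
      then show "G x ^ n \<le> ?e n (k + 1)"
        unfolding G_power by (simp add: mult.commute add.commute)
    qed
    have high: "\<bar>P n x - G x ^ n\<bar> \<le> \<epsilon>" if "1 \<le> n" "v m0 \<le> x" for n x
    proof (cases "\<exists>k. x < v k")
      case True
      \<comment> \<open>Locate \<open>x\<close> between two consecutive levels.\<close>
      define l where "l = (LEAST k. x < v k)"
      have l: "x < v l"
        unfolding l_def by (rule LeastI_ex[OF True])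
      have "m0 < l"
      proof (rule ccontr)
        assume "\<not> m0 < l"
        then have "v l \<le> v m0" by (intro incseqD[OF v]) simp
        with l that show False by linarith
      qed
      then obtain k where k: "l = Suc k" "m0 \<le> k"
        by (metis less_imp_Suc_add le_add1)
      have "v k \<le> x"
        using not_less_Least[of k "\<lambda>k. x < v k"] k(1) unfolding l_def by auto
      note lo = lower[OF k(2) that(1) this]
      have up: "P n x \<le> ?e n (k + 2) + \<delta>" "G x ^ n \<le> ?e n (k + 2)"
        using upper[of "Suc k" n x] that(1) l k by (auto simp: algebra_simps)
      have "?e n (k + 2) - ?e n (?a k) \<le> (k + 2) / ?a k - 1"
        using e_width[OF that(1), of "?a k" "k + 2"] m0(4)[OF k(2)] first_index_le[of k] by simp
      with m0(3)[OF k(2)] have "?e n (k + 2) - ?e n (?a k) \<le> \<delta>"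
        unfolding of_nat_add of_nat_numeral by linarith
      with lo up show ?thesis
        unfolding \<delta>_def by linarith
    next
      case False
      \<comment> \<open>Here \<open>x\<close> lies above every level, so the lower bound is available for arbitrarily large \<open>k\<close>.\<close>
      have "filterlim (\<lambda>k. real (?a k)) at_top sequentially"
        by (rule filterlim_compose[OF filterlim_real_sequentially first_index_at_top])
      then have "(\<lambda>k. \<beta> * n / ?a k) \<longlonglongrightarrow> 0"
        by (intro tendsto_divide_0[OF tendsto_const] filterlim_at_top_imp_at_infinity)
      then have "(\<lambda>k. ?e n (?a k)) \<longlonglongrightarrow> 1"
        using tendsto_exp[OF tendsto_minus] by fastforce
      then have "\<forall>\<^sub>F k in sequentially. 1 - \<delta> < ?e n (?a k)"
        using \<open>0 < \<delta>\<close> by (intro order_tendstoD(1)) auto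
      then obtain k where "m0 \<le> k" "1 - \<delta> < ?e n (?a k)"
        by (auto simp: eventually_sequentially) (metis nat_le_linear)
      with lower[OF this(1) \<open>1 \<le> n\<close>, of x] False G_bounds[of x n] le_one[of n x] show ?thesis
        unfolding \<delta>_def by (auto simp: not_less abs_le_iff)
    qed
    define k where "k = max m0 1"
    have low: "\<bar>P n x - G x ^ n\<bar> \<le> ?e n (k + 1) + \<delta>" if "1 \<le> n" "x \<le> v m0" for n x
    proof -
      have "x \<le> v k"
        using that incseqD[OF v, of m0 k] by (simp add: k_def)
      with upper[of k n x] that \<open>0 < \<delta>\<close> nonneg[of n x] G_bounds[of x n] show ?thesis
        by (simp add: k_def abs_le_iff)
    qed
    have "(\<lambda>n. ?e n (k + 1)) \<longlonglongrightarrow> 0"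
    proof -
      have "filterlim (\<lambda>n. (\<beta> / (k + 1)) * real n) at_top sequentially"
        using \<beta> by (intro filterlim_tendsto_pos_mult_at_top[OF tendsto_const _ filterlim_real_sequentially])
           simp
      then have "filterlim (\<lambda>n. - (\<beta> * real n / real (k + 1))) at_bot sequentially"
        by (simp add: filterlim_uminus_at_bot)
      then show ?thesis
        by (rule filterlim_compose[OF exp_at_bot])
    qed
    then have "\<forall>\<^sub>F n in sequentially. ?e n (k + 1) < \<delta>"
      using \<open>0 < \<delta>\<close> by (rule order_tendstoD)
    then show ?thesis
      using eventually_ge_at_top[of 1]
    proof eventually_elim
      case (elim n)
      show ?case
      proof
        fix x
        show "\<bar>P n x - G x ^ n\<bar> \<le> \<epsilon>"
          using high[OF elim(2), of x] low[OF elim(2), of x] elim(1) unfolding \<delta>_def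
          by linarith
      qed
    qed
  qed
  ultimately show thesis
    using that G_cont by blast
qed

end
end

section \<open>Partial maxima of random variables\<close>

text \<open>
  The uniform bound guarantees that the suprema are genuine: an unbounded real supremum would be
  unspecified.
\<close>
lemma tendsto_SUP_abs_iff:
  fixes f :: "nat \<Rightarrow> 'b \<Rightarrow> real"
  assumes bound: "\<And>n x. \<bar>f n x\<bar> \<le> B"
  shows "(\<lambda>n. SUP x. \<bar>f n x\<bar>) \<longlonglongrightarrow> 0 \<longleftrightarrow> (\<forall>\<epsilon>>0. \<forall>\<^sub>F n in sequentially. \<forall>x. \<bar>f n x\<bar> \<le> \<epsilon>)"
proof -
  have bdd: "bdd_above (range (\<lambda>x. \<bar>f n x\<bar>))" for n
    using bound by (intro bdd_aboveI2)
  have SUP_le_iff: "(SUP x. \<bar>f n x\<bar>) \<le> \<epsilon> \<longleftrightarrow> (\<forall>x. \<bar>f n x\<bar> \<le> \<epsilon>)" for n \<epsilon>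
    using cSUP_le_iff[OF _ bdd[of n]] by simp
  have SUP_nonneg: "0 \<le> (SUP x. \<bar>f n x\<bar>)" for n
    using cSUP_upper2[OF bdd[of n], of undefined 0] by simp
  show ?thesis
    unfolding SUP_le_iff[symmetric]
  proof
    assume lim: "(\<lambda>n. SUP x. \<bar>f n x\<bar>) \<longlonglongrightarrow> 0"
    show "\<forall>\<epsilon>>0. \<forall>\<^sub>F n in sequentially. (SUP x. \<bar>f n x\<bar>) \<le> \<epsilon>"
      by (intro allI impI eventually_mono[OF order_tendstoD(2)[OF lim]] less_imp_le)
  next
    assume le: "\<forall>\<epsilon>>0. \<forall>\<^sub>F n in sequentially. (SUP x. \<bar>f n x\<bar>) \<le> \<epsilon>"
    show "(\<lambda>n. SUP x. \<bar>f n x\<bar>) \<longlonglongrightarrow> 0"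
    proof (rule order_tendstoI)
      fix e :: real assume "0 < e"
      then have "\<forall>\<^sub>F n in sequentially. (SUP x. \<bar>f n x\<bar>) \<le> e / 2"
        using le half_gt_zero by blast
      then show "\<forall>\<^sub>F n in sequentially. (SUP x. \<bar>f n x\<bar>) < e"
        by eventually_elim (use \<open>0 < e\<close> in linarith)
    next
      fix e :: real assume "e < 0"
      then show "\<forall>\<^sub>F n in sequentially. e < (SUP x. \<bar>f n x\<bar>)"
        using SUP_nonneg by (auto intro!: always_eventually intro: less_le_trans)
    qed
  qed
qed

context
  fixes M :: "'a measure" and X :: "nat \<Rightarrow> 'a \<Rightarrow> real"
  assumes M: "prob_space M" and X: "\<And>j. X j \<in> borel_measurable M"
begin

lemma partial_max_le_iff: "1 \<le> n \<Longrightarrow> partial_max X n \<omega> \<le> x \<longleftrightarrow> (\<forall>j<n. X j \<omega> \<le> x)"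
  unfolding partial_max_def by (subst Max_le_iff) auto

lemma partial_max_laws:
  "maximum_laws (\<lambda>n x. measure M {\<omega>\<in>space M. partial_max X n \<omega> \<le> x})"
proof -
  interpret prob_space M by (fact M)
  have meas: "{\<omega>\<in>space M. partial_max X n \<omega> \<le> x} \<in> sets M" if "1 \<le> n" for n x
    using X by (simp add: partial_max_le_iff[OF that])
  show ?thesis
  proof
    show "prob {\<omega>\<in>space M. partial_max X n \<omega> \<le> x} \<le> prob {\<omega>\<in>space M. partial_max X n \<omega> \<le> y}"
      if "1 \<le> n" "x \<le> y" for n x y
      using meas that by (intro finite_measure_mono) auto
    show "prob {\<omega>\<in>space M. partial_max X n \<omega> \<le> x} \<le> prob {\<omega>\<in>space M. partial_max X m \<omega> \<le> x}"
      if "1 \<le> m" "m \<le> n" for m n x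
    proof (intro finite_measure_mono meas)
      have "1 \<le> n" using that by simp
      then show "{\<omega>\<in>space M. partial_max X n \<omega> \<le> x} \<subseteq> {\<omega>\<in>space M. partial_max X m \<omega> \<le> x}"
        using that by (auto simp: partial_max_le_iff)
    qed (use that in auto)
  qed auto
qed

lemma phantom_df_iff:
  "phantom_df M X G \<longleftrightarrow> distribution_function G \<and> (\<forall>\<epsilon>>0. \<forall>\<^sub>F n in sequentially.
     \<forall>x. \<bar>measure M {\<omega>\<in>space M. partial_max X n \<omega> \<le> x} - G x ^ n\<bar> \<le> \<epsilon>)"
proof (cases "distribution_function G")
  case True
  then obtain N where N: "real_distribution N" "G = cdf N"
    unfolding distribution_function_def by blast
  interpret N: real_distribution N by (fact N)
  interpret maximum_laws "\<lambda>n x. measure M {\<omega>\<in>space M. partial_max X n \<omega> \<le> x}"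
    by (rule partial_max_laws)
  have "\<bar>measure M {\<omega>\<in>space M. partial_max X n \<omega> \<le> x} - G x ^ n\<bar> \<le> 1" for n x
  proof -
    have "0 \<le> G x ^ n" "G x ^ n \<le> 1"
      using N.cdf_nonneg[of x] N.cdf_bounded_prob[of x] by (auto simp: N power_le_one)
    then show ?thesis
      using nonneg[of n x] le_one[of n x] by linarith
  qed
  from tendsto_SUP_abs_iff[OF this] True show ?thesis
    by (simp add: phantom_df_def)
qed (simp add: phantom_df_def)

lemma continuous_phantom_imp_regular:
  assumes "phantom_df M X G" "continuous_on UNIV G"
  shows "regular_df G"
  using assms continuous_imp_regular by (simp add: phantom_df_def)

lemma regular_phantom_imp_levels:
  assumes "phantom_df M X G" "regular_df G" "0 < \<beta>"
  shows "\<exists>v. incseq v \<and> (\<forall>t>0. level_convergence M X v \<beta> t)"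
proof -
  have "distribution_function G"
    and "\<And>\<epsilon>. 0 < \<epsilon> \<Longrightarrow> \<forall>\<^sub>F n in sequentially.
      \<forall>x. \<bar>measure M {\<omega>\<in>space M. partial_max X n \<omega> \<le> x} - G x ^ n\<bar> \<le> \<epsilon>"
    using assms(1) by (auto simp: phantom_df_iff)
  from regular_phantom_levels[OF this(1) assms(2,3) this(2)] show ?thesis
    unfolding level_convergence_def by blast
qed

lemma levels_imp_continuous_phantom:
  assumes \<beta>: "0 < \<beta>" and v: "incseq v" and D: "D \<subseteq> {0<..}" "{0<..} \<subseteq> closure D"
    and conv: "\<forall>t\<in>D. level_convergence M X v \<beta> t"
  shows "\<exists>G. phantom_df M X G \<and> continuous_on UNIV G"
proof -
  interpret maximum_laws "\<lambda>n x. measure M {\<omega>\<in>space M. partial_max X n \<omega> \<le> x}"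
    by (rule partial_max_laws)
  have "\<forall>\<^sub>F k in sequentially. \<forall>n\<ge>1.
      \<bar>measure M {\<omega>\<in>space M. partial_max X n \<omega> \<le> v k} - exp (- (\<beta> * n / k))\<bar> \<le> \<epsilon>"
    if "0 < \<epsilon>" for \<epsilon>
    using uniform_in_index[OF \<beta> D _ that] conv by (simp add: level_convergence_def)
  from continuous_phantom[OF \<beta> v this] show ?thesis
    unfolding phantom_df_iff by blast
qed

end

theorem theorem3:
  fixes M :: "'a measure" and X :: "nat \<Rightarrow> 'a \<Rightarrow> real"
  assumes "prob_space M"
    and "\<And>j. X j \<in> borel_measurable M"
  shows
    "((\<exists>G. phantom_df M X G \<and> continuous_on UNIV G) \<longleftrightarrow>
        (\<exists>G. phantom_df M X G \<and> regular_df G)) \<and>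
     ((\<exists>G. phantom_df M X G \<and> continuous_on UNIV G) \<longleftrightarrow>
        (\<exists>\<beta>>0. \<exists>v. incseq v \<and>
          (\<exists>D\<subseteq>{0<..}. {0<..} \<subseteq> closure D \<and> (\<forall>t\<in>D. level_convergence M X v \<beta> t)))) \<and>
     ((\<exists>G. phantom_df M X G \<and> continuous_on UNIV G) \<longleftrightarrow>
        (\<forall>\<beta>>0. \<exists>v. incseq v \<and> (\<forall>t>0. level_convergence M X v \<beta> t)))"
    (is "(?i \<longleftrightarrow> ?ii) \<and> (?i \<longleftrightarrow> ?iii) \<and> (?i \<longleftrightarrow> ?iv)")
proof -
  have "?i \<Longrightarrow> ?ii"
    using continuous_phantom_imp_regular[where X = X, OF assms] by blast
  moreover have "?ii \<Longrightarrow> ?iv"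
    using regular_phantom_imp_levels[where X = X, OF assms] by blast
  moreover have ?iii if iv: ?iv
  proof -
    obtain v where v: "incseq v" "\<forall>t>0. level_convergence M X v 1 t"
      using iv zero_less_one by blast
    have "{0<..} \<subseteq> closure {0::real<..}"
      by (rule closure_subset)
    with v show ?iii
      by (intro exI[of _ 1] exI[of _ v] conjI exI[of _ "{0<..}"]) auto
  qed
  moreover have "?iii \<Longrightarrow> ?i"
    using levels_imp_continuous_phantom[where X = X, OF assms] by blast
  ultimately show ?thesis by blast
qed

end
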